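(* Let $\delta>0$ and let $\omega=(q_n)_{n=1}^{\infty}$ and $\widetilde\omega=(\tilde q_n)_{n=1}^{\infty}$ be sequences of real numbers in $(0,1)$ with $q_n\ge\delta$ and $\tilde q_n\ge\delta$ for all $n\in\mathbb N$. Suppose that $\lim_{n\to\infty}\log\frac{1-\tilde q_n}{1-q_n}=0$. Then the Hausdorff dimension of the random Cantor set $E(\widetilde\omega)$ is the same as that of the random Cantor set $E(\omega)$.
   Context: Random Cantor set $E(\omega)$: for a sequence $\omega=(q_n)_{n\ge1}$ with $0<q_n<1$, put $E_0=[0,1]$. Inductively, $E_k$ is a disjoint union of $2^k$ closed intervals of equal length, and $E_{k+1}$ is obtained from $E_k$ by removing from each of these closed intervals $I$ the concentric open interval of length $q_{k+1}|I|$, where $|I|$ is the length of $I$. Then $E(\omega)=\bigcap_{k\ge1}E_k$. (Despite the name, the construction is deterministic.) *)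

theory Defs
  imports "HOL-Analysis.Analysis"
begin

section \<open>Hausdorff measure and Hausdorff dimension\<close>

text \<open>
  The usual conventions \<open>diam(U)^0 = 1\<close> for nonempty \<open>U\<close> and \<open>diam({})^s = 0\<close> are made explicit,
  because \<open>0 powr 0 = 0\<close> in Isabelle/HOL.
\<close>

definition hausdorff_gauge :: "real \<Rightarrow> 'a::metric_space set \<Rightarrow> real" where
  "hausdorff_gauge s U =
     (if U = {} then 0 else if s = 0 then 1 else diameter U powr s)"

text \<open>
  Boundedness is required separately: \<^const>\<open>diameter\<close> is real-valued and carries no information
  on unbounded sets.  Finite covers are included, since the pieces may be empty.
\<close>

definition hausdorff_premeasure :: "real \<Rightarrow> real \<Rightarrow> 'a::metric_space set \<Rightarrow> ennreal" where
  "hausdorff_premeasure s \<epsilon> A =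
     (INF U \<in> {U :: nat \<Rightarrow> 'a set. A \<subseteq> (\<Union>i. U i) \<and> (\<forall>i. bounded (U i) \<and> diameter (U i) \<le> \<epsilon>)}.
        \<Sum>i. ennreal (hausdorff_gauge s (U i)))"

definition hausdorff_measure :: "real \<Rightarrow> 'a::metric_space set \<Rightarrow> ennreal" where
  "hausdorff_measure s A = (SUP \<epsilon> \<in> {0<..}. hausdorff_premeasure s \<epsilon> A)"

definition hausdorff_dim :: "'a::metric_space set \<Rightarrow> ennreal" where
  "hausdorff_dim A = (INF s \<in> {s. 0 \<le> s \<and> hausdorff_measure s A = 0}. ennreal s)"


section \<open>The Cantor set of a sequence of removal ratios\<close>

text \<open>
  The intervals making up the \<open>k\<close>-th level, each given by its pair of endpoints.  Sequences are
  indexed from 1; the value \<open>q 0\<close> is never used.  By the lemma that follows, passing from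
  \<open>(a, b)\<close> to its two successors removes from \<open>{a..b}\<close> the concentric open interval of length
  \<open>q (Suc k) * (b - a)\<close>.
\<close>

fun cantor_intervals :: "(nat \<Rightarrow> real) \<Rightarrow> nat \<Rightarrow> (real \<times> real) set" where
  "cantor_intervals q 0 = {(0, 1)}"
| "cantor_intervals q (Suc k) =
     (\<Union>(a, b) \<in> cantor_intervals q k.
        {(a, (a + b) / 2 - q (Suc k) * (b - a) / 2),
         ((a + b) / 2 + q (Suc k) * (b - a) / 2, b)})"

lemma remove_concentric_interval:
  fixes a b r :: real
  assumes "a < b" "0 < r" "r < 1"
  shows "{a..b} - {(a + b) / 2 - r * (b - a) / 2 <..< (a + b) / 2 + r * (b - a) / 2} =
         {a..(a + b) / 2 - r * (b - a) / 2} \<union> {(a + b) / 2 + r * (b - a) / 2..b}"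
proof -
  have "0 < r * (b - a)" "r * (b - a) < b - a"
    using assms by (auto simp: mult_less_cancel_right)
  then show ?thesis by (auto simp: field_simps)
qed

definition cantor_level :: "(nat \<Rightarrow> real) \<Rightarrow> nat \<Rightarrow> real set" where
  "cantor_level q k = (\<Union>(a, b) \<in> cantor_intervals q k. {a..b})"

definition random_cantor_set :: "(nat \<Rightarrow> real) \<Rightarrow> real set" where
  "random_cantor_set q = (\<Inter>k \<in> {1..}. cantor_level q k)"

end

theory Submission
  imports Defs
begin

text \<open>
  Code the points of \<open>E(\<omega>)\<close> by binary sequences, recording at each level whether the left or the
  right subinterval is taken.  Two points whose codes first differ at place \<open>j\<close> lie in a common
  interval of level \<open>j\<close>, of length \<open>L\<^sub>j\<close>, and are separated by the gap removed from it, so their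
  distance is between \<open>\<delta> L\<^sub>j\<close> and \<open>L\<^sub>j\<close>.  As \<open>L\<^sub>k \<le> 2 powr (-k)\<close> and the logarithms of the contraction
  ratios are asymptotically equal, \<open>L'\<^sub>k \<le> C L\<^sub>k powr \<eta>\<close> for every \<open>\<eta> < 1\<close>.  Hence matching points with
  equal codes is \<open>\<eta>\<close>-Hoelder in both directions, and the dimensions differ at most by a factor
  \<open>1 / \<eta>\<close>; let \<open>\<eta>\<close> tend to 1.
\<close>

section \<open>Hausdorff dimension under Hoelder correspondences\<close>

lemma hausdorff_measure_eq_0_iff:
  "hausdorff_measure s A = 0 \<longleftrightarrow> (\<forall>\<epsilon>>0. hausdorff_premeasure s \<epsilon> A = 0)"
  by (auto simp: hausdorff_measure_def SUP_eq_iff)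

lemma hausdorff_premeasure_le:
  assumes "A \<subseteq> (\<Union>i. U i)" "\<And>i. bounded (U i)" "\<And>i. diameter (U i) \<le> \<epsilon>"
  shows "hausdorff_premeasure s \<epsilon> A \<le> (\<Sum>i. ennreal (hausdorff_gauge s (U i)))"
  unfolding hausdorff_premeasure_def by (rule INF_lower) (use assms in auto)

lemma hausdorff_dim_le: "0 \<le> s \<Longrightarrow> hausdorff_measure s A = 0 \<Longrightarrow> hausdorff_dim A \<le> ennreal s"
  unfolding hausdorff_dim_def by (rule INF_lower) auto

text \<open>Both maps start from one index type, so no map from \<open>range f\<close> to
  \<open>range g\<close> has to be named. The bound makes \<open>g x\<close> depend on
  \<open>f x\<close> alone, since \<open>0 powr \<eta> = 0\<close>.\<close>

context
  fixes f :: "'c \<Rightarrow> 'a::metric_space" and g :: "'c \<Rightarrow> 'b::metric_space" and K \<eta> :: real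
  assumes K: "0 < K" and \<eta>: "0 < \<eta>"
    and hoelder: "\<And>x y. dist (g x) (g y) \<le> K * dist (f x) (f y) powr \<eta>"
begin

lemma hoelder_transfer_dist:
  assumes "bounded U" "x \<in> f -` U" "y \<in> f -` U"
  shows "dist (g x) (g y) \<le> K * diameter U powr \<eta>"
proof -
  have "dist (f x) (f y) \<le> diameter U"
    using assms by (intro diameter_bounded_bound) auto
  then have "K * dist (f x) (f y) powr \<eta> \<le> K * diameter U powr \<eta>"
    using K \<eta> by (intro mult_left_mono powr_mono2) auto
  then show ?thesis using hoelder [of x y] by linarith
qed

lemma hoelder_transfer_bounded: "bounded U \<Longrightarrow> bounded (g ` (f -` U))"
  unfolding bounded_two_points [of "g ` (f -` U)"]
  by (intro exI [of _ "K * diameter U powr \<eta>"]) (auto intro: hoelder_transfer_dist)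

lemma hoelder_transfer_diameter:
  assumes "bounded U"
  shows "diameter (g ` (f -` U)) \<le> K * diameter U powr \<eta>"
proof (cases "f -` U = {}")
  case True
  then show ?thesis using K by (simp add: diameter_def)
next
  case False
  have "(SUP (x, y)\<in>g ` (f -` U) \<times> g ` (f -` U). dist x y) \<le> K * diameter U powr \<eta>"
    using assms False by (intro cSUP_least) (auto intro: hoelder_transfer_dist)
  then show ?thesis
    using False by (auto simp: diameter_def [of "g ` (f -` U)"])
qed

text \<open>Raising \<open>diameter U powr \<eta>\<close> to the power \<open>s / \<eta>\<close>
  restores the exponent \<open>s\<close>. The case \<open>s = 0\<close> is separate because the
  gauge is then 1 on nonempty sets by convention.\<close>

lemma hoelder_transfer_gauge:
  assumes "bounded U" "0 \<le> s"
  shows "hausdorff_gauge (s / \<eta>) (g ` (f -` U)) \<le> K powr (s / \<eta>) * hausdorff_gauge s U"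
proof (cases "f -` U = {}")
  case True
  then show ?thesis by (auto simp: hausdorff_gauge_def)
next
  case False
  then have ne: "U \<noteq> {}" by auto
  show ?thesis
  proof (cases "s = 0")
    case True
    with False ne K show ?thesis by (auto simp: hausdorff_gauge_def)
  next
    case s: False
    have "diameter (g ` (f -` U)) powr (s / \<eta>) \<le> (K * diameter U powr \<eta>) powr (s / \<eta>)"
      using assms \<eta> by (intro powr_mono2 hoelder_transfer_diameter)
        (auto simp: diameter_ge_0 hoelder_transfer_bounded)
    also have "\<dots> = K powr (s / \<eta>) * diameter U powr s"
      using K \<eta> by (simp add: powr_mult powr_powr)
    finally show ?thesis
      using False ne s \<eta> by (simp add: hausdorff_gauge_def)
  qed
qed

text \<open>A cover of \<open>range f\<close>, pulled back along \<open>f\<close> and pushed forward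
  along \<open>g\<close>, covers \<open>range g\<close>; its gauge sum grows at most by the factor
  \<open>K powr (s / \<eta>)\<close>.\<close>

lemma hausdorff_measure_0_hoelder:
  assumes "0 \<le> s" "hausdorff_measure s (range f) = 0"
  shows "hausdorff_measure (s / \<eta>) (range g) = 0"
  unfolding hausdorff_measure_eq_0_iff
proof (intro allI impI)
  fix \<epsilon>' :: real assume "0 < \<epsilon>'"
  \<comment> \<open>This solves \<open>K * \<epsilon> powr \<eta> = \<epsilon>'\<close>, so
    transferred sets have diameter at most \<open>\<epsilon>'\<close>.\<close>
  define \<epsilon> where "\<epsilon> = (\<epsilon>' / K) powr (1 / \<eta>)"
  define c where "c = K powr (s / \<eta>)"
  have c: "0 < c" using K by (simp add: c_def)
  have "0 < \<epsilon>" using \<open>0 < \<epsilon>'\<close> K by (simp add: \<epsilon>_def)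
  then have null: "hausdorff_premeasure s \<epsilon> (range f) = 0"
    using assms by (simp add: hausdorff_measure_eq_0_iff)
  have "hausdorff_premeasure (s / \<eta>) \<epsilon>' (range g) \<le> 0"
  proof (rule ennreal_le_epsilon)
    fix e :: real assume "0 < e"
    then have "hausdorff_premeasure s \<epsilon> (range f) < ennreal (e / c)"
      using c by (simp add: null)
    then obtain U where cover: "range f \<subseteq> (\<Union>i. U i)"
      and U: "\<And>i. bounded (U i)" "\<And>i. diameter (U i) \<le> \<epsilon>"
      and sum: "(\<Sum>i. ennreal (hausdorff_gauge s (U i))) < ennreal (e / c)"
      unfolding hausdorff_premeasure_def INF_less_iff by auto
    have "diameter (g ` (f -` U i)) \<le> \<epsilon>'" for i
    proof -
      have "diameter (U i) powr \<eta> \<le> \<epsilon> powr \<eta>"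
        using U \<eta> by (intro powr_mono2) (auto simp: diameter_ge_0)
      also have "\<dots> = \<epsilon>' / K"
        using \<eta> K \<open>0 < \<epsilon>'\<close> by (simp add: \<epsilon>_def powr_powr)
      finally have "K * diameter (U i) powr \<eta> \<le> \<epsilon>'"
        using K by (simp add: field_simps)
      then show ?thesis using hoelder_transfer_diameter [OF U(1)] by (rule order_trans [rotated])
    qed
    then have "hausdorff_premeasure (s / \<eta>) \<epsilon>' (range g)
        \<le> (\<Sum>i. ennreal (hausdorff_gauge (s / \<eta>) (g ` (f -` U i))))"
      using cover U by (intro hausdorff_premeasure_le) (fastforce simp: hoelder_transfer_bounded)+
    also have "\<dots> \<le> (\<Sum>i. ennreal c * ennreal (hausdorff_gauge s (U i)))"
      unfolding c_def using U assms
      by (intro suminf_le) (auto simp: ennreal_mult' [symmetric] intro!: ennreal_leI hoelder_transfer_gauge)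
    also have "\<dots> = ennreal c * (\<Sum>i. ennreal (hausdorff_gauge s (U i)))"
      by simp
    also have "\<dots> \<le> ennreal c * ennreal (e / c)"
      using sum by (intro mult_left_mono) auto
    also have "\<dots> = ennreal e"
      using c \<open>0 < e\<close> by (simp flip: ennreal_mult)
    finally show "hausdorff_premeasure (s / \<eta>) \<epsilon>' (range g) \<le> 0 + ennreal e" by simp
  qed
  then show "hausdorff_premeasure (s / \<eta>) \<epsilon>' (range g) = 0" by simp
qed

end

lemma hausdorff_dim_le_of_almost_lipschitz:
  fixes f :: "'c \<Rightarrow> 'a::metric_space" and g :: "'c \<Rightarrow> 'b::metric_space"
  assumes "\<And>\<eta>. 0 < \<eta> \<Longrightarrow> \<eta> < 1 \<Longrightarrow>
    \<exists>K>0. \<forall>x y. dist (g x) (g y) \<le> K * dist (f x) (f y) powr \<eta>"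
  shows "hausdorff_dim (range g) \<le> hausdorff_dim (range f)"
  unfolding hausdorff_dim_def [of "range f"]
proof (rule INF_greatest, clarify)
  fix s :: real assume s: "0 \<le> s" "hausdorff_measure s (range f) = 0"
  show "hausdorff_dim (range g) \<le> ennreal s"
  proof (rule ennreal_le_epsilon)
    fix e :: real assume e: "0 < e"
    \<comment> \<open>Lies strictly between 0 and 1 even for \<open>s = 0\<close>, and
      \<open>s / \<eta> \<le> s + e\<close> because
      \<open>s * (s + 2 * e) \<le> (s + e)^2\<close>.\<close>
    define \<eta> where "\<eta> = (s + e) / (s + 2 * e)"
    have \<eta>: "0 < \<eta>" "\<eta> < 1" using s e by (auto simp: \<eta>_def)
    then obtain K where "0 < K" "\<And>x y. dist (g x) (g y) \<le> K * dist (f x) (f y) powr \<eta>"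
      using assms by blast
    then have "hausdorff_dim (range g) \<le> ennreal (s / \<eta>)"
      using s \<eta> by (intro hausdorff_dim_le hausdorff_measure_0_hoelder) auto
    also have "s / \<eta> \<le> s + e"
      using s e by (simp add: \<eta>_def field_simps)
    then have "ennreal (s / \<eta>) \<le> ennreal s + ennreal e"
      using s e by (simp flip: ennreal_plus add: ennreal_leI)
    finally show "hausdorff_dim (range g) \<le> ennreal s + ennreal e" .
  qed
qed


section \<open>Coding the Cantor set by binary sequences\<close>

definition cantor_length :: "(nat \<Rightarrow> real) \<Rightarrow> nat \<Rightarrow> real" where
  "cantor_length q k = (\<Prod>i<k. (1 - q (Suc i)) / 2)"

text \<open>An entry \<open>True\<close> selects the right subinterval, whose left endpoint is
  shifted by the parent's length minus the child's.\<close>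

definition left_endpoint :: "(nat \<Rightarrow> real) \<Rightarrow> (nat \<Rightarrow> bool) \<Rightarrow> nat \<Rightarrow> real" where
  "left_endpoint q b k = (\<Sum>j<k. if b j then cantor_length q j - cantor_length q (Suc j) else 0)"

text \<open>For ratios in (0, 1) the left endpoints increase along a code, so the supremum is their
  limit, the common point of the nested intervals.\<close>

definition cantor_point :: "(nat \<Rightarrow> real) \<Rightarrow> (nat \<Rightarrow> bool) \<Rightarrow> real" where
  "cantor_point q b = Sup (range (left_endpoint q b))"

lemma cantor_length_0 [simp]: "cantor_length q 0 = 1"
  by (simp add: cantor_length_def)

lemma cantor_length_Suc: "cantor_length q (Suc k) = cantor_length q k * ((1 - q (Suc k)) / 2)"
  by (simp add: cantor_length_def)

lemma left_endpoint_0 [simp]: "left_endpoint q b 0 = 0"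
  by (simp add: left_endpoint_def)

lemma left_endpoint_Suc:
  "left_endpoint q b (Suc k) =
     left_endpoint q b k + (if b k then cantor_length q k - cantor_length q (Suc k) else 0)"
  by (simp add: left_endpoint_def)

lemma left_endpoint_cong: "(\<And>j. j < k \<Longrightarrow> b j = c j) \<Longrightarrow> left_endpoint q b k = left_endpoint q c k"
  by (simp add: left_endpoint_def)

text \<open>Infinite codes serve for every finite level, since only the first \<open>k\<close>
  entries matter there; the two children come from resetting entry \<open>k\<close>.\<close>

lemma cantor_intervals_eq:
  "cantor_intervals q k = range (\<lambda>b. (left_endpoint q b k, left_endpoint q b k + cantor_length q k))"
proof (induction k)
  case 0
  then show ?case by auto
next
  case (Suc k)
  let ?I = "\<lambda>b k. (left_endpoint q b k, left_endpoint q b k + cantor_length q k)"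
  have upd: "left_endpoint q (b(k := v)) k = left_endpoint q b k" for b v
    by (rule left_endpoint_cong) auto
  have children: "(case ?I b k of (l, r) \<Rightarrow> {(l, (l + r) / 2 - q (Suc k) * (r - l) / 2),
      ((l + r) / 2 + q (Suc k) * (r - l) / 2, r)}) = {?I (b(k := False)) (Suc k), ?I (b(k := True)) (Suc k)}"
    for b
    by (auto simp: left_endpoint_Suc upd cantor_length_Suc algebra_simps add_divide_distrib diff_divide_distrib)
  \<comment> \<open>A code equals one of its two updates at place \<open>k\<close>, so the updates
    exhaust the next level.\<close>
  have "?I b (Suc k) \<in> {?I (b(k := False)) (Suc k), ?I (b(k := True)) (Suc k)}" for b
    by (cases "b k") (simp_all add: left_endpoint_Suc upd)
  then have "range (\<lambda>b. ?I b (Suc k)) = (\<Union>b. {?I (b(k := False)) (Suc k), ?I (b(k := True)) (Suc k)})"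
    by blast
  with children show ?case
    by (simp add: Suc)
qed

locale removal_ratios =
  fixes q :: "nat \<Rightarrow> real"
  assumes q_pos: "\<And>n. 1 \<le> n \<Longrightarrow> 0 < q n" and q_less_1: "\<And>n. 1 \<le> n \<Longrightarrow> q n < 1"
begin

abbreviation "L \<equiv> cantor_length q"
abbreviation "left \<equiv> left_endpoint q"
abbreviation "pt \<equiv> cantor_point q"

lemma cantor_length_pos: "0 < L k"
  by (auto simp: cantor_length_def intro!: prod_pos q_less_1)

lemma cantor_length_Suc_le_half: "L (Suc k) \<le> L k / 2"
  using q_pos [of "Suc k"] cantor_length_pos [of k] by (simp add: cantor_length_Suc)

lemma cantor_length_Suc_le: "L (Suc k) \<le> L k"
  using cantor_length_Suc_le_half [of k] cantor_length_pos [of k] by simp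

lemma cantor_length_tendsto_0: "L \<longlonglongrightarrow> 0"
proof (rule tendsto_sandwich)
  have "L k \<le> (1 / 2) ^ k" for k
  proof (induction k)
    case (Suc k)
    then show ?case using cantor_length_Suc_le_half [of k] by simp
  qed simp
  then show "\<forall>\<^sub>F k in sequentially. L k \<le> (1 / 2) ^ k" by simp
  show "\<forall>\<^sub>F k in sequentially. 0 \<le> L k" by (simp add: cantor_length_pos less_imp_le)
qed (auto intro: LIMSEQ_realpow_zero)

section \<open>Nested intervals along a code\<close>

lemma left_endpoint_mono: "j \<le> k \<Longrightarrow> left b j \<le> left b k"
  by (rule lift_Suc_mono_le [of "left b"]) (use cantor_length_Suc_le in \<open>auto simp: left_endpoint_Suc\<close>)

lemma right_endpoint_antimono: "j \<le> k \<Longrightarrow> left b k + L k \<le> left b j + L j"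
  by (rule lift_Suc_antimono_le [of "\<lambda>k. left b k + L k"])
    (use cantor_length_Suc_le in \<open>auto simp: left_endpoint_Suc\<close>)

text \<open>Both endpoints are compared at level \<open>max j k\<close>. The resulting upper bound
  on the left endpoints makes the supremum in \<open>cantor_point\<close> meaningful.\<close>

lemma left_le_right_endpoint: "left b j \<le> left b k + L k"
  using left_endpoint_mono [of j "max j k" b] right_endpoint_antimono [of k "max j k" b]
    cantor_length_pos [of "max j k"] by simp

lemma left_endpoint_le_cantor_point: "left b k \<le> pt b"
  unfolding cantor_point_def
  by (rule cSUP_upper) (use left_le_right_endpoint in \<open>auto intro!: bdd_aboveI2\<close>)

lemma cantor_point_le_right_endpoint: "pt b \<le> left b k + L k"
  unfolding cantor_point_def by (rule cSUP_least) (auto intro: left_le_right_endpoint)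

lemma cantor_point_unique:
  assumes "\<And>k. left b k \<le> x" "\<And>k. x \<le> left b k + L k"
  shows "x = pt b"
proof -
  have "\<bar>x - pt b\<bar> \<le> L k" for k
    using assms [of k] left_endpoint_le_cantor_point [of b k] cantor_point_le_right_endpoint [of b k]
    by linarith
  then have "\<bar>x - pt b\<bar> \<le> 0"
    by (intro LIMSEQ_le_const [OF cantor_length_tendsto_0]) auto
  then show ?thesis by simp
qed

text \<open>At level \<open>Suc j\<close> the two intervals are siblings separated by the removed
  gap. Later intervals stay inside them, so the levels \<open>k\<close> and \<open>m\<close> may
  differ.\<close>

lemma intervals_gap:
  assumes "\<And>i. i < j \<Longrightarrow> b i = c i" "\<not> b j" "c j" "j < k" "j < m"
  shows "left b k + L k + q (Suc j) * L j \<le> left c m"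
proof -
  have "left b j = left c j" using assms by (intro left_endpoint_cong) auto
  then have "left c (Suc j) = left b (Suc j) + L (Suc j) + q (Suc j) * L j"
    using assms by (simp add: left_endpoint_Suc cantor_length_Suc field_simps)
  then show ?thesis
    using assms right_endpoint_antimono [of "Suc j" k b] left_endpoint_mono [of "Suc j" m c] by simp
qed

text \<open>At a first disagreement \<open>x\<close> would lie on both sides of a gap of positive
  length. Unequal levels are allowed in order to glue codes found at different levels.\<close>

lemma common_point_codes_agree:
  assumes "left b k \<le> x" "x \<le> left b k + L k" "left c m \<le> x" "x \<le> left c m + L m" "j < k" "j < m"
  shows "b j = c j"
  using assms(5,6)
proof (induction j rule: less_induct)
  case (less j)
  then have eq: "\<And>i. i < j \<Longrightarrow> b i = c i" by auto
  have "0 < q (Suc j) * L j" using q_pos cantor_length_pos by simp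
  then show ?case
    using intervals_gap [of j b c k m] intervals_gap [of j c b m k] eq less.prems assms(1-4)
    by (cases "b j"; cases "c j") auto
qed

lemma random_cantor_set_eq: "random_cantor_set q = range pt"
proof (intro equalityI subsetI)
  fix x assume "x \<in> range pt"
  then show "x \<in> random_cantor_set q"
    using left_endpoint_le_cantor_point cantor_point_le_right_endpoint
    by (fastforce simp: random_cantor_set_def cantor_level_def cantor_intervals_eq)
next
  fix x assume "x \<in> random_cantor_set q"
  then have "\<forall>k\<in>{1..}. \<exists>b. left b k \<le> x \<and> x \<le> left b k + L k"
    by (auto simp: random_cantor_set_def cantor_level_def cantor_intervals_eq)
  then obtain \<beta> where \<beta>: "\<And>k. 1 \<le> k \<Longrightarrow> left (\<beta> k) k \<le> x" "\<And>k. 1 \<le> k \<Longrightarrow> x \<le> left (\<beta> k) k + L k"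
    by (auto dest!: bchoice)
  \<comment> \<open>Each level supplies its own code for \<open>x\<close>. These codes agree where
    their levels overlap, so entry \<open>j\<close> is read off at level \<open>Suc j\<close>, the
    first that determines it.\<close>
  define b where "b j = \<beta> (Suc j) j" for j
  have in_interval: "left b k \<le> x \<and> x \<le> left b k + L k" if "1 \<le> k" for k
  proof -
    have "b j = \<beta> k j" if "j < k" for j
      unfolding b_def
      by (rule common_point_codes_agree [of _ "Suc j" x _ k]) (use \<beta> \<open>1 \<le> k\<close> that in auto)
    then have "left b k = left (\<beta> k) k" by (rule left_endpoint_cong)
    with \<beta> that show ?thesis by simp
  qed
  \<comment> \<open>The intersection starts at level 1; level 0 follows because its interval
    contains that of level 1.\<close>
  have "left b k \<le> x \<and> x \<le> left b k + L k" for k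
    using in_interval [of k] in_interval [of 1] left_endpoint_mono [of 0 1 b]
      right_endpoint_antimono [of 0 1 b] by (cases k) auto
  then show "x \<in> range pt" using cantor_point_unique by blast
qed

section \<open>Distances between coded points\<close>

lemma dist_cantor_point_le:
  assumes "\<And>i. i < j \<Longrightarrow> b i = c i"
  shows "dist (pt b) (pt c) \<le> L j"
proof -
  have "left b j = left c j" using assms by (rule left_endpoint_cong)
  then show ?thesis
    using left_endpoint_le_cantor_point [of b j] cantor_point_le_right_endpoint [of b j]
      left_endpoint_le_cantor_point [of c j] cantor_point_le_right_endpoint [of c j]
    by (simp add: dist_real_def abs_le_iff)
qed

text \<open>The points lie on opposite sides of the gap removed from their common interval of level
  \<open>j\<close>.\<close>

lemma dist_cantor_point_ge:
  assumes "\<And>i. i < j \<Longrightarrow> b i = c i" "b j \<noteq> c j"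
  shows "q (Suc j) * L j \<le> dist (pt b) (pt c)"
proof -
  have *: "q (Suc j) * L j \<le> pt v - pt u" if "\<And>i. i < j \<Longrightarrow> u i = v i" "\<not> u j" "v j" for u v
    using intervals_gap [of j u v "Suc j" "Suc j"] that
      left_endpoint_le_cantor_point [of v "Suc j"] cantor_point_le_right_endpoint [of u "Suc j"]
    by simp
  show ?thesis
    using *[of b c] *[of c b] assms by (cases "b j"; cases "c j") (auto simp: dist_real_def)
qed

end


section \<open>Comparing two sequences of ratios\<close>

text \<open>From some level on the quotient \<open>R k\<close> does not increase, because the new
  factors satisfy \<open>r' \<le> r powr \<eta>\<close>. The earlier levels affect only the
  constant.\<close>

lemma cantor_length_le_powr:
  assumes "removal_ratios q" "removal_ratios q'" "\<eta> < 1"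
    and lim: "(\<lambda>n. ln ((1 - q' n) / (1 - q n))) \<longlonglongrightarrow> 0"
  shows "\<exists>C>0. \<forall>k. cantor_length q' k \<le> C * cantor_length q k powr \<eta>"
proof -
  interpret Q: removal_ratios q by fact
  interpret Q': removal_ratios q' by fact
  define R where "R k = Q'.L k / Q.L k powr \<eta>" for k
  \<comment> \<open>As \<open>r \<le> 1 / 2\<close> gives \<open>ln 2 \<le> - ln r\<close>, this
    threshold turns \<open>ln r' < ln r + (1 - \<eta>) * ln 2\<close> into
    \<open>ln r' \<le> \<eta> * ln r\<close>.\<close>
  have "\<forall>\<^sub>F n in sequentially. ln ((1 - q' n) / (1 - q n)) < (1 - \<eta>) * ln 2"
    using assms by (intro order_tendstoD [OF lim]) auto
  then obtain N where N: "\<And>n. N \<le> n \<Longrightarrow> ln ((1 - q' n) / (1 - q n)) < (1 - \<eta>) * ln 2"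
    by (auto simp: eventually_sequentially)
  have R_Suc: "R (Suc k) \<le> R k" if "N \<le> k" for k
  proof -
    define r r' where "r = (1 - q (Suc k)) / 2" and "r' = (1 - q' (Suc k)) / 2"
    have r: "0 < r" "r \<le> 1 / 2" and r': "0 < r'"
      using Q.q_pos [of "Suc k"] Q.q_less_1 [of "Suc k"] Q'.q_less_1 [of "Suc k"]
      by (auto simp: r_def r'_def)
    have "ln (r' / r) < (1 - \<eta>) * ln 2"
    proof -
      have "1 - q (Suc k) = 2 * r" "1 - q' (Suc k) = 2 * r'" by (simp_all add: r_def r'_def)
      then show ?thesis using N [of "Suc k"] that by simp
    qed
    moreover have "ln r \<le> ln (1 / 2)" using r by simp
    then have "(1 - \<eta>) * ln 2 \<le> (1 - \<eta>) * - ln r"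
      using assms by (intro mult_left_mono) (auto simp: ln_div)
    ultimately have "ln r' \<le> \<eta> * ln r"
      using r r' by (simp add: ln_div algebra_simps)
    then have "r' \<le> r powr \<eta>"
      using r r' by (subst ln_le_cancel_iff [symmetric]) auto
    then have "R k * (r' / r powr \<eta>) \<le> R k * 1"
      using r Q'.cantor_length_pos [of k]
      by (intro mult_left_mono) (auto simp: R_def)
    then show ?thesis
      using r Q.cantor_length_pos [of k]
      by (simp add: R_def cantor_length_Suc powr_mult flip: r_def r'_def)
  qed
  define C where "C = Max (R ` {..N})"
  have R_le: "R k \<le> C" for k
  proof (cases "k \<le> N")
    case True
    then show ?thesis by (auto simp: C_def)
  next
    case False
    then have "N \<le> k" by simp
    then have "R k \<le> R N"
    proof (induction k rule: dec_induct)
      case (step k)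
      then show ?case using R_Suc [of k] by linarith
    qed simp
    then show ?thesis by (auto simp: C_def intro: order_trans)
  qed
  have "0 < R 0" by (simp add: R_def)
  then have "0 < C" using R_le [of 0] by simp
  moreover have "Q'.L k \<le> C * Q.L k powr \<eta>" for k
    using R_le [of k] Q.cantor_length_pos [of k] by (simp add: R_def divide_le_eq)
  ultimately show ?thesis by blast
qed

text \<open>If the codes first differ at \<open>j\<close> and the points have distances
  \<open>d\<close> and \<open>d'\<close>, then \<open>d' \<le> L' j \<le> C * L j powr \<eta> \<le>
  C * (d / \<delta>) powr \<eta>\<close>, which dictates \<open>K\<close>.\<close>

lemma cantor_point_hoelder:
  assumes "removal_ratios q" "removal_ratios q'" "0 < \<delta>" "\<And>n. 1 \<le> n \<Longrightarrow> \<delta> \<le> q n"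
    and "(\<lambda>n. ln ((1 - q' n) / (1 - q n))) \<longlonglongrightarrow> 0" "0 < \<eta>" "\<eta> < 1"
  shows "\<exists>K>0. \<forall>b c. dist (cantor_point q' b) (cantor_point q' c)
           \<le> K * dist (cantor_point q b) (cantor_point q c) powr \<eta>"
proof -
  interpret Q: removal_ratios q by fact
  interpret Q': removal_ratios q' by fact
  obtain C where C: "0 < C" "\<And>k. Q'.L k \<le> C * Q.L k powr \<eta>"
    using cantor_length_le_powr [OF assms(1,2,7,5)] by blast
  define K where "K = C / \<delta> powr \<eta>"
  have "dist (Q'.pt b) (Q'.pt c) \<le> K * dist (Q.pt b) (Q.pt c) powr \<eta>" for b c
  proof (cases "b = c")
    case True
    then show ?thesis by simp
  next
    case False
    then have "\<exists>j. b j \<noteq> c j" by auto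
    then obtain j where j: "b j \<noteq> c j" and agree: "\<And>i. i < j \<Longrightarrow> b i = c i"
      using exists_least_iff [of "\<lambda>j. b j \<noteq> c j"] by auto
    have "\<delta> * Q.L j \<le> q (Suc j) * Q.L j"
      using assms Q.cantor_length_pos [of j] by (intro mult_right_mono) auto
    also have "\<dots> \<le> dist (Q.pt b) (Q.pt c)"
      using agree j by (intro Q.dist_cantor_point_ge) auto
    finally have "Q.L j \<le> dist (Q.pt b) (Q.pt c) / \<delta>"
      using assms by (simp add: field_simps)
    then have "Q.L j powr \<eta> \<le> (dist (Q.pt b) (Q.pt c) / \<delta>) powr \<eta>"
      using assms Q.cantor_length_pos [of j] by (intro powr_mono2) auto
    then have "C * Q.L j powr \<eta> \<le> K * dist (Q.pt b) (Q.pt c) powr \<eta>"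
      using C assms by (simp add: K_def powr_divide field_simps)
    moreover have "dist (Q'.pt b) (Q'.pt c) \<le> Q'.L j"
      using agree by (rule Q'.dist_cantor_point_le)
    ultimately show ?thesis using C(2) [of j] by linarith
  qed
  moreover have "0 < K" using C assms by (simp add: K_def)
  ultimately show ?thesis by blast
qed

lemma hausdorff_dim_random_cantor_set_le:
  assumes "removal_ratios q" "removal_ratios q'" "0 < \<delta>" "\<And>n. 1 \<le> n \<Longrightarrow> \<delta> \<le> q n"
    and "(\<lambda>n. ln ((1 - q' n) / (1 - q n))) \<longlonglongrightarrow> 0"
  shows "hausdorff_dim (random_cantor_set q') \<le> hausdorff_dim (random_cantor_set q)"
  unfolding removal_ratios.random_cantor_set_eq [OF assms(1)]
    removal_ratios.random_cantor_set_eq [OF assms(2)]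
  by (rule hausdorff_dim_le_of_almost_lipschitz) (rule cantor_point_hoelder [OF assms])

theorem corollary1p4:
  fixes \<delta> :: real and q q' :: "nat \<Rightarrow> real"
  assumes "\<delta> > 0"
    and "\<And>n. n \<ge> 1 \<Longrightarrow> 0 < q n \<and> q n < 1"
    and "\<And>n. n \<ge> 1 \<Longrightarrow> 0 < q' n \<and> q' n < 1"
    and "\<And>n. n \<ge> 1 \<Longrightarrow> q n \<ge> \<delta>"
    and "\<And>n. n \<ge> 1 \<Longrightarrow> q' n \<ge> \<delta>"
    and "(\<lambda>n. ln ((1 - q' n) / (1 - q n))) \<longlonglongrightarrow> 0"
  shows "hausdorff_dim (random_cantor_set q') = hausdorff_dim (random_cantor_set q)"
proof (rule antisym)
  have R: "removal_ratios q" "removal_ratios q'"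
    using assms(2,3) by (auto simp: removal_ratios_def)
  show "hausdorff_dim (random_cantor_set q') \<le> hausdorff_dim (random_cantor_set q)"
    using assms R by (intro hausdorff_dim_random_cantor_set_le [of q q' \<delta>]) auto
  \<comment> \<open>Exchanging the sequences negates the logarithm. The identity is claimed only
    eventually, as the values at index 0 are unconstrained.\<close>
  have "\<forall>\<^sub>F n in sequentially. - ln ((1 - q' n) / (1 - q n)) = ln ((1 - q n) / (1 - q' n))"
    using eventually_ge_at_top [of 1] by eventually_elim (use assms(2,3) in \<open>simp add: ln_div\<close>)
  then have "(\<lambda>n. ln ((1 - q n) / (1 - q' n))) \<longlonglongrightarrow> 0"
    using tendsto_minus [OF assms(6)] by (simp add: tendsto_cong)
  then show "hausdorff_dim (random_cantor_set q) \<le> hausdorff_dim (random_cantor_set q')"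
    using assms R by (intro hausdorff_dim_random_cantor_set_le [of q' q \<delta>]) auto
qed

end
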